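(* Let $G$ be a graph, let $\ell$ be a weak harmonic labeling of $G$ onto an integer interval, and let $\mathcal{A}=\mathcal{A}_{(G,\ell)}$. Then for all $A,B\in\mathcal{A}$: (P1) $\bigcup_{C\in\mathcal{A}}C$ is an integer interval; (P2) $av(A)\neq av(B)$ if $A\neq B$; (P3) if $t\in A\cap B$ and $A\neq B$, then there exists $C\in\mathcal{A}$ such that $av(C)=t$; (P4) if $av(A)\in B$ then $av(B)\in A$; (P5) there exists a finite sequence $A_{i_1},\ldots,A_{i_r}$ of members of $\mathcal{A}$ such that $A_{i_1}=A$, $A_{i_r}=B$ and $av(A_{i_j})\in A_{i_{j+1}}$ for $1\le j\le r-1$.
   Context: Graphs are simple, connected, of bounded degree, with at least three vertices (finite or infinite). $V_G$ is the vertex set, $v\sim w$ means adjacency, $S_G$ is the set of leaves (vertices of degree one), and $N_G(v)=\{v\}\cup\{w: w\sim v\}$. An integer interval is a (finite or infinite) set of consecutive integers. A weak harmonic labeling of $G$ onto an integer interval $I$ is a bijection $\ell:V_G\to I$ with $\ell(v)=\frac{1}{\deg(v)}\sum_{w\sim v}\ell(w)$ for every $v\in V_G\setminus S_G$. For a nonempty finite $A\subset\mathbb{Z}$, $av(A)=\frac{1}{|A|}\sum_{k\in A}k$. The collection $\mathcal{A}_{(G,\ell)}$ is $\{A_v: v\in V_G\setminus S_G\}$ where $A_v=\{\ell(w): w\in N_G(v)\}$. *)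

theory Defs
  imports Complex_Main "Graph_Theory.Graph_Theory"
begin

text \<open>
  A simple undirected graph is a symmetric, loop-free digraph whose arcs are pairs of vertices, so
  that no parallel arcs exist. The library's \<open>graph\<close> and \<open>pair_graph\<close> are not used because they
  require finitely many vertices.

  Each edge gives rise to exactly one outgoing arc at each of its ends, hence the degree of \<open>v\<close> is
  \<open>out_degree G v\<close>. As \<open>card\<close> sends infinite sets to 0, local finiteness is a separate part of
  the bounded degree condition.
\<close>

locale bounded_degree_graph = pair_bidirected_digraph G for G :: "'a pair_pre_digraph" +
  assumes connected_graph: "connected (with_proj G)"
    and bounded_degree:
      "\<exists>d. \<forall>v \<in> pverts G. finite (out_arcs (with_proj G) v) \<and> out_degree (with_proj G) v \<le> d"
    and three_vertices: "infinite (pverts G) \<or> card (pverts G) \<ge> 3"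

abbreviation degree :: "'a pair_pre_digraph \<Rightarrow> 'a \<Rightarrow> nat" where
  "degree G v \<equiv> out_degree (with_proj G) v"

definition leaves :: "'a pair_pre_digraph \<Rightarrow> 'a set" where
  "leaves G = {v \<in> pverts G. degree G v = 1}"

definition neighbors :: "'a pair_pre_digraph \<Rightarrow> 'a \<Rightarrow> 'a set" where
  "neighbors G v = {w. v \<rightarrow>\<^bsub>with_proj G\<^esub> w}"

definition closed_neighborhood :: "'a pair_pre_digraph \<Rightarrow> 'a \<Rightarrow> 'a set" where
  "closed_neighborhood G v = insert v (neighbors G v)"

definition integer_interval :: "int set \<Rightarrow> bool" where
  "integer_interval I \<longleftrightarrow> I \<noteq> {} \<and> (\<forall>a \<in> I. \<forall>b \<in> I. {a..b} \<subseteq> I)"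

definition weak_harmonic_labeling :: "'a pair_pre_digraph \<Rightarrow> int set \<Rightarrow> ('a \<Rightarrow> int) \<Rightarrow> bool" where
  "weak_harmonic_labeling G I l \<longleftrightarrow>
     integer_interval I \<and> bij_betw l (pverts G) I \<and>
     (\<forall>v \<in> pverts G - leaves G.
        real_of_int (l v) = 1 / real (degree G v) * (\<Sum>w \<in> neighbors G v. real_of_int (l w)))"

definition av :: "int set \<Rightarrow> real" where
  "av A = 1 / real (card A) * (\<Sum>k \<in> A. real_of_int k)"

definition label_collection :: "'a pair_pre_digraph \<Rightarrow> ('a \<Rightarrow> int) \<Rightarrow> int set set" where
  "label_collection G l = {l ` closed_neighborhood G v | v. v \<in> pverts G - leaves G}"

end

theory Submission
  imports Defs
begin

text \<open>
  The inner vertices (those that are not leaves) are in bijection with the members of the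
  collection: harmonicity says that the label of an inner vertex \<open>v\<close> is the average of \<open>A\<^sub>v\<close>, so
  the average recovers \<open>v\<close> from \<open>A\<^sub>v\<close> (lemma \<open>av_closed_neighborhood\<close>), and \<open>av A\<^sub>v \<in> A\<^sub>w\<close> means
  that \<open>v\<close> and \<open>w\<close> are equal or adjacent. This turns the five properties into statements about the
  graph.

  For (P1), every vertex lies in the closed neighbourhood of an inner vertex, because two adjacent
  leaves would form a connected component with only two vertices; so the union is the whole interval
  of labels. (P2) is the injectivity of the labeling. For (P3), a common element of \<open>A\<^sub>v\<close> and \<open>A\<^sub>w\<close>
  is the label of a vertex in two closed neighbourhoods, and a leaf lies in the closed neighbourhood
  of only one inner vertex. (P4) is the symmetry of adjacency. For (P5), the inner vertices of a
  connected graph induce a connected subgraph (lemma \<open>inner_vertices_connected\<close>), since a walk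
  that enters a leaf has to return to where it came from.
\<close>

section \<open>Walks inside a set of vertices\<close>

lemma rtrancl_Restr_imp_successively:
  assumes "(x, y) \<in> (Restr R S)\<^sup>*" "y \<in> S"
  shows "\<exists>xs. xs \<noteq> [] \<and> set xs \<subseteq> S \<and> hd xs = x \<and> last xs = y \<and>
    successively (\<lambda>a b. (a, b) \<in> R) xs"
  using assms(1)
proof (induction rule: converse_rtrancl_induct)
  case base
  show ?case using assms(2) by (intro exI[of _ "[y]"]) simp
next
  case (step a b)
  then obtain xs where xs: "xs \<noteq> []" "set xs \<subseteq> S" "hd xs = b" "last xs = y"
    "successively (\<lambda>a b. (a, b) \<in> R) xs"
    by blast
  then show ?case
    using step.hyps(1) by (intro exI[of _ "a # xs"]) (auto simp: successively_Cons)
qed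

section \<open>Neighbourhoods and leaves\<close>

lemma neighbors_eq: "neighbors G v = {w. (v, w) \<in> parcs G}"
  by (simp add: neighbors_def)

lemma out_arcs_eq_neighbors: "out_arcs (with_proj G) v = Pair v ` neighbors G v"
  by (auto simp: neighbors_eq)

lemma degree_eq_card_neighbors: "degree G v = card (neighbors G v)"
  by (simp add: out_degree_def out_arcs_eq_neighbors card_image inj_on_def)

lemma leaf_iff_single_neighbor:
  "v \<in> leaves G \<longleftrightarrow> v \<in> pverts G \<and> (\<exists>w. neighbors G v = {w})"
  by (simp add: leaves_def degree_eq_card_neighbors card_1_singleton_iff)

abbreviation nonleaves :: "'a pair_pre_digraph \<Rightarrow> 'a set" where
  "nonleaves G \<equiv> pverts G - leaves G"

context bounded_degree_graph
begin

lemma finite_neighbors: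
  assumes "v \<in> pverts G"
  shows "finite (neighbors G v)"
proof -
  have "finite (Pair v ` neighbors G v)"
    using bounded_degree assms by (auto simp flip: out_arcs_eq_neighbors)
  then show ?thesis
    by (rule finite_imageD) (simp add: inj_on_def)
qed

lemma closed_neighborhood_subset:
  "v \<in> pverts G \<Longrightarrow> closed_neighborhood G v \<subseteq> pverts G"
  by (auto simp: closed_neighborhood_def neighbors_eq dest: in_arcsD2)

lemma closed_neighborhood_sym:
  "v \<in> closed_neighborhood G w \<longleftrightarrow> w \<in> closed_neighborhood G v"
  by (auto simp: closed_neighborhood_def neighbors_eq intro: arcs_symmetric)

lemma not_in_neighbors_self: "v \<notin> neighbors G v"
  by (auto simp: neighbors_eq dest: pair_no_loops)

lemma vertices_reachable:
  assumes "u \<in> pverts G" "v \<in> pverts G"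
  shows "u \<rightarrow>\<^sup>*\<^bsub>with_proj G\<^esub> v"
  using symmetric_connected_imp_strongly_connected[OF pair_sym_arcs connected_graph] assms
  by (auto simp: strongly_connected_def)

section \<open>Inner vertices of a connected graph\<close>

text \<open>
  If a leaf and its only neighbour were both leaves, no walk could leave these two vertices, and
  the connected graph would have no third one.
\<close>

lemma neighbor_of_leaf_is_inner:
  assumes u: "u \<in> leaves G" and nu: "neighbors G u = {x}"
  shows "x \<in> nonleaves G"
proof -
  have x: "x \<in> pverts G" and xu: "u \<in> neighbors G x"
    using nu by (auto simp: neighbors_eq dest: in_arcsD2 arcs_symmetric)
  have "x \<notin> leaves G"
  proof
    assume "x \<in> leaves G"
    then have nx: "neighbors G x = {u}"
      using xu by (auto simp: leaf_iff_single_neighbor)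
    have "v \<in> {u, x}" if "v \<in> pverts G" for v
    proof -
      have "u \<rightarrow>\<^sup>*\<^bsub>with_proj G\<^esub> v"
        using u that by (intro vertices_reachable) (auto simp: leaves_def)
      then show ?thesis
        by (induction rule: reachable_induct) (use nu nx in \<open>auto simp: neighbors_eq\<close>)
    qed
    then have "pverts G \<subseteq> {u, x}" by blast
    then have "finite (pverts G)" "card (pverts G) \<le> card {u, x}"
      by (auto intro: finite_subset card_mono)
    moreover have "card {u, x} \<le> 2" by (simp add: card_insert_if)
    ultimately show False using three_vertices by linarith
  qed
  with x show ?thesis by blast
qed

lemma inner_closed_neighborhoods_cover:
  "(\<Union>v \<in> nonleaves G. closed_neighborhood G v) = pverts G"
proof
  show "(\<Union>v \<in> nonleaves G. closed_neighborhood G v) \<subseteq> pverts G"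
    using closed_neighborhood_subset by blast
  show "pverts G \<subseteq> (\<Union>v \<in> nonleaves G. closed_neighborhood G v)"
  proof
    fix u assume u: "u \<in> pverts G"
    show "u \<in> (\<Union>v \<in> nonleaves G. closed_neighborhood G v)"
    proof (cases "u \<in> leaves G")
      case True
      then obtain x where x: "neighbors G u = {x}"
        by (auto simp: leaf_iff_single_neighbor)
      then have "u \<in> closed_neighborhood G x"
        using closed_neighborhood_sym[of u x] by (simp add: closed_neighborhood_def)
      then show ?thesis using neighbor_of_leaf_is_inner[OF True x] by blast
    qed (use u in \<open>auto simp: closed_neighborhood_def\<close>)
  qed
qed

text \<open>
  A leaf differs from \<open>v\<close> and \<open>w\<close>, which are not leaves, so both have to be its only neighbour.
\<close>

lemma leaf_in_unique_inner_closed_neighborhood: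
  assumes "u \<in> leaves G" "v \<in> nonleaves G" "w \<in> nonleaves G"
    and "u \<in> closed_neighborhood G v" "u \<in> closed_neighborhood G w"
  shows "v = w"
proof -
  have "v \<in> neighbors G u" "w \<in> neighbors G u"
    using assms closed_neighborhood_sym[of u] by (auto simp: closed_neighborhood_def)
  then show ?thesis using assms(1) by (auto simp: leaf_iff_single_neighbor)
qed

text \<open>
  Along a walk from the inner vertex \<open>v\<close>, the last inner vertex visited stays reachable within the
  inner vertices: the current vertex is either this inner vertex itself or a leaf attached to it,
  and from such a leaf the walk can only step back. This avoids any appeal to simple paths.
\<close>

lemma inner_vertices_connected:
  assumes v: "v \<in> nonleaves G" and w: "w \<in> nonleaves G"
  shows "(v, w) \<in> (Restr (parcs G) (nonleaves G))\<^sup>*"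
proof -
  let ?R = "Restr (parcs G) (nonleaves G)"
  have "v \<rightarrow>\<^sup>*\<^bsub>with_proj G\<^esub> w"
    using v w by (intro vertices_reachable) auto
  then have "\<exists>x \<in> nonleaves G. (v, x) \<in> ?R\<^sup>* \<and> (w = x \<or> w \<in> leaves G \<and> x \<in> neighbors G w)"
  proof (induction rule: reachable_induct)
    case base
    show ?case using v by blast
  next
    case (step y z)
    then obtain x where x: "x \<in> nonleaves G" "(v, x) \<in> ?R\<^sup>*"
      and y: "y = x \<or> y \<in> leaves G \<and> x \<in> neighbors G y"
      by blast
    have yz: "(y, z) \<in> parcs G" using step.hyps(2) by simp
    from y show ?case
    proof
      assume "y \<in> leaves G \<and> x \<in> neighbors G y"
      moreover have "z \<in> neighbors G y" using yz by (simp add: neighbors_eq)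
      ultimately have "z = x" by (auto simp: leaf_iff_single_neighbor)
      then show ?thesis using x by blast
    next
      assume "y = x"
      show ?thesis
      proof (cases "z \<in> leaves G")
        case True
        then show ?thesis
          using x yz \<open>y = x\<close> by (auto simp: neighbors_eq intro: arcs_symmetric)
      next
        case False
        then have "z \<in> nonleaves G" using yz by (auto dest: in_arcsD2)
        moreover from this have "(x, z) \<in> ?R" using x yz \<open>y = x\<close> by blast
        ultimately show ?thesis using x(2) by (blast intro: rtrancl_into_rtrancl)
      qed
    qed
  qed
  then show ?thesis using w by auto
qed

section \<open>Averages of labels over closed neighbourhoods\<close>

text \<open>
  The label of \<open>v\<close> is the average over its neighbours, and including \<open>l v\<close> itself does not change
  an average that is equal to \<open>l v\<close>.
\<close>

lemma av_closed_neighborhood: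
  assumes l: "weak_harmonic_labeling G I l" and v: "v \<in> nonleaves G"
  shows "av (l ` closed_neighborhood G v) = real_of_int (l v)"
proof -
  let ?N = "neighbors G v"
  have fin: "finite ?N" using v finite_neighbors by blast
  have inj: "inj_on l (closed_neighborhood G v)"
    using l v closed_neighborhood_subset
    by (auto simp: weak_harmonic_labeling_def bij_betw_def intro: inj_on_subset)
  have harm: "real_of_int (l v) = 1 / real (card ?N) * (\<Sum>w \<in> ?N. real_of_int (l w))"
    using l v by (simp add: weak_harmonic_labeling_def degree_eq_card_neighbors)
  \<comment> \<open>The sum over an empty neighbourhood is 0, so that clearing the denominator is harmless even
    where the quotient has the default value of division by 0.\<close>
  have sum_N: "(\<Sum>w \<in> ?N. real_of_int (l w)) = real (card ?N) * real_of_int (l v)"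
  proof (cases "?N = {}")
    case False
    then have "real (card ?N) \<noteq> 0" using fin by simp
    then show ?thesis using harm by (simp add: field_simps)
  qed simp
  have card: "card (l ` closed_neighborhood G v) = Suc (card ?N)"
    using card_image[OF inj] fin not_in_neighbors_self by (simp add: closed_neighborhood_def)
  have "(\<Sum>k \<in> l ` closed_neighborhood G v. real_of_int k)
      = (\<Sum>w \<in> closed_neighborhood G v. real_of_int (l w))"
    using inj by (simp add: sum.reindex)
  also have "\<dots> = (1 + real (card ?N)) * real_of_int (l v)"
    using fin not_in_neighbors_self by (simp add: closed_neighborhood_def sum_N algebra_simps)
  finally show ?thesis
    unfolding av_def card by simp
qed

lemma label_in_image_closed_neighborhood_iff:
  assumes "weak_harmonic_labeling G I l" "u \<in> pverts G" "v \<in> pverts G"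
  shows "l u \<in> l ` closed_neighborhood G v \<longleftrightarrow> u \<in> closed_neighborhood G v"
proof -
  have "inj_on l (pverts G)"
    using assms(1) by (simp add: weak_harmonic_labeling_def bij_betw_def)
  then show ?thesis
    using assms(2) closed_neighborhood_subset[OF assms(3)] by (rule inj_on_image_mem_iff)
qed

lemma av_in_closed_neighborhood_iff:
  assumes "weak_harmonic_labeling G I l" "v \<in> nonleaves G" "w \<in> nonleaves G"
  shows "av (l ` closed_neighborhood G v) \<in> real_of_int ` l ` closed_neighborhood G w
    \<longleftrightarrow> v \<in> closed_neighborhood G w"
proof -
  have "av (l ` closed_neighborhood G v) \<in> real_of_int ` l ` closed_neighborhood G w
      \<longleftrightarrow> l v \<in> l ` closed_neighborhood G w"
    using av_closed_neighborhood[OF assms(1,2)] by (simp add: inj_image_mem_iff inj_def)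
  also have "\<dots> \<longleftrightarrow> v \<in> closed_neighborhood G w"
    using assms by (intro label_in_image_closed_neighborhood_iff) auto
  finally show ?thesis .
qed

lemma chain_of_closed_neighborhoods:
  assumes l: "weak_harmonic_labeling G I l" and v: "v \<in> nonleaves G" and w: "w \<in> nonleaves G"
  shows "\<exists>As. As \<noteq> [] \<and> set As \<subseteq> label_collection G l \<and>
    hd As = l ` closed_neighborhood G v \<and> last As = l ` closed_neighborhood G w \<and>
    (\<forall>j. Suc j < length As \<longrightarrow> av (As ! j) \<in> real_of_int ` (As ! Suc j))"
proof -
  obtain xs where xs: "xs \<noteq> []" "set xs \<subseteq> nonleaves G" "hd xs = v" "last xs = w"
    "successively (\<lambda>a b. (a, b) \<in> parcs G) xs"
    using rtrancl_Restr_imp_successively[OF inner_vertices_connected[OF v w] w] by blast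
  let ?A = "\<lambda>v. l ` closed_neighborhood G v"
  have "av (?A (xs ! j)) \<in> real_of_int ` ?A (xs ! Suc j)" if j: "Suc j < length xs" for j
  proof -
    have "(xs ! j, xs ! Suc j) \<in> parcs G"
      using xs(5) j by (auto simp: successively_conv_nth)
    then have "xs ! j \<in> closed_neighborhood G (xs ! Suc j)"
      by (auto simp: closed_neighborhood_def neighbors_eq intro: arcs_symmetric)
    moreover have "xs ! j \<in> nonleaves G" "xs ! Suc j \<in> nonleaves G"
      using xs(2) j by (meson Suc_lessD nth_mem subsetD)+
    ultimately show ?thesis using av_in_closed_neighborhood_iff[OF l] by blast
  qed
  moreover have "set (map ?A xs) \<subseteq> label_collection G l"
    using xs(2) by (auto simp: label_collection_def)
  ultimately show ?thesis
    using xs(1,3,4) by (intro exI[of _ "map ?A xs"]) (simp add: hd_map last_map)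
qed

end

theorem lemma14:
  fixes G :: "'a pair_pre_digraph" and l :: "'a \<Rightarrow> int" and I :: "int set"
    and \<A> :: "int set set"
  assumes "bounded_degree_graph G"
    and "weak_harmonic_labeling G I l"
    and "\<A> = label_collection G l"
  shows "integer_interval (\<Union>C \<in> \<A>. C) \<and>
    (\<forall>A \<in> \<A>. \<forall>B \<in> \<A>.
      (A \<noteq> B \<longrightarrow> av A \<noteq> av B) \<and>
      (\<forall>t. t \<in> A \<inter> B \<and> A \<noteq> B \<longrightarrow> (\<exists>C \<in> \<A>. av C = real_of_int t)) \<and>
      (av A \<in> real_of_int ` B \<longrightarrow> av B \<in> real_of_int ` A) \<and>
      (\<exists>As. As \<noteq> [] \<and> set As \<subseteq> \<A> \<and> hd As = A \<and> last As = B \<and>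
        (\<forall>j. Suc j < length As \<longrightarrow> av (As ! j) \<in> real_of_int ` (As ! Suc j))))"
proof -
  interpret bounded_degree_graph G by fact
  note l = assms(2)
  let ?A = "\<lambda>v. l ` closed_neighborhood G v"
  have coll: "\<A> = ?A ` nonleaves G"
    using assms(3) by (auto simp: label_collection_def)
  have bij: "bij_betw l (pverts G) I" and I: "integer_interval I"
    using l by (auto simp: weak_harmonic_labeling_def)
  have "(\<Union>C \<in> \<A>. C) = l ` (\<Union>v \<in> nonleaves G. closed_neighborhood G v)"
    unfolding coll by blast
  also have "\<dots> = I"
    using bij by (simp add: inner_closed_neighborhoods_cover bij_betw_def)
  finally have P1: "integer_interval (\<Union>C \<in> \<A>. C)" using I by simp
  have P2: "av (?A v) \<noteq> av (?A w)"
    if "v \<in> nonleaves G" "w \<in> nonleaves G" "?A v \<noteq> ?A w" for v w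
  proof -
    have "l v \<noteq> l w"
      using that bij by (auto simp: bij_betw_def dest: inj_onD)
    then show ?thesis using that av_closed_neighborhood[OF l] by simp
  qed
  have P3: "\<exists>C \<in> \<A>. av C = real_of_int t"
    if v: "v \<in> nonleaves G" and w: "w \<in> nonleaves G"
      and t: "t \<in> ?A v \<inter> ?A w" and "?A v \<noteq> ?A w" for v w t
  proof -
    obtain u where u: "t = l u" "u \<in> closed_neighborhood G v" using t by blast
    have uG: "u \<in> pverts G" using u v closed_neighborhood_subset by blast
    have "u \<in> closed_neighborhood G w"
      using t u uG w label_in_image_closed_neighborhood_iff[OF l uG] by simp
    then have "u \<in> nonleaves G"
      using leaf_in_unique_inner_closed_neighborhood[OF _ v w] u(2) uG \<open>?A v \<noteq> ?A w\<close> by blast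
    then show ?thesis
      using av_closed_neighborhood[OF l] u(1) unfolding coll by blast
  qed
  have P4: "av (?A w) \<in> real_of_int ` ?A v"
    if "v \<in> nonleaves G" "w \<in> nonleaves G" "av (?A v) \<in> real_of_int ` ?A w" for v w
    using that av_in_closed_neighborhood_iff[OF l] closed_neighborhood_sym by blast
  have P5: "\<exists>As. As \<noteq> [] \<and> set As \<subseteq> \<A> \<and> hd As = ?A v \<and> last As = ?A w \<and>
      (\<forall>j. Suc j < length As \<longrightarrow> av (As ! j) \<in> real_of_int ` (As ! Suc j))"
    if "v \<in> nonleaves G" "w \<in> nonleaves G" for v w
    using chain_of_closed_neighborhoods[OF l that] assms(3) by simp
  show ?thesis
  proof (intro conjI ballI P1)
    fix A B assume "A \<in> \<A>" "B \<in> \<A>"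
    then obtain v w where v: "v \<in> nonleaves G" and w: "w \<in> nonleaves G"
      and AB: "A = ?A v" "B = ?A w"
      unfolding coll by blast
    show "A \<noteq> B \<longrightarrow> av A \<noteq> av B"
      using P2[OF v w] AB by simp
    show "\<forall>t. t \<in> A \<inter> B \<and> A \<noteq> B \<longrightarrow> (\<exists>C \<in> \<A>. av C = real_of_int t)"
      using P3[OF v w] unfolding AB by blast
    show "av A \<in> real_of_int ` B \<longrightarrow> av B \<in> real_of_int ` A"
      using P4[OF v w] unfolding AB by blast
    show "\<exists>As. As \<noteq> [] \<and> set As \<subseteq> \<A> \<and> hd As = A \<and> last As = B \<and>
        (\<forall>j. Suc j < length As \<longrightarrow> av (As ! j) \<in> real_of_int ` (As ! Suc j))"
      using P5[OF v w] unfolding AB .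
  qed
qed

end
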